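(* Let $T\in\mathbb{C}^{n\times n}$ be a diagonalizable Toeplitz matrix with all eigenvalues real and contained in $(-\infty,\mu]$ for some $\mu\in\mathbb{R}$. Let $X$ be an invertible matrix such that $X^{-1}TX$ is diagonal. Then for every integer $s\ge 1$, \[ \min\{\|\exp(T)-A\|_2 : A\in\mathbb{C}^{n\times n},\ \operatorname{rank}(\nabla(A))\le 2s+1\}\le \tilde C\,V^{-s}, \] where $\tilde C=\kappa(X)\,e^{\mu}\,C$ and $\kappa(X)=\|X\|_2\|X^{-1}\|_2$ is the condition number of $X$.
   Context: $Z\in\mathbb{C}^{n\times n}$ is the downward shift matrix (ones on the first subdiagonal, zeros elsewhere) and $\nabla(A)=A-ZAZ^*$. A Toeplitz matrix is one that is constant along each diagonal. $\mathcal{P}_s$ denotes the polynomials of degree at most $s$. The constants $C$ and $V\approx 9.28903$ are those of the theorem of Gonchar and Rakhmanov, i.e. constants such that for all $s\ge 1$ \[ \inf_{p_1,p_2\in\mathcal{P}_s}\ \max_{\lambda\in(-\infty,0]}\left|e^{\lambda}-\frac{p_1(\lambda)}{p_2(\lambda)}\right|\le C\,V^{-s}. \] *)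

theory Defs
  imports "HOL-Analysis.Analysis" "HOL-Computational_Algebra.Polynomial"
begin

text \<open>
  An \<open>n \<times> n\<close> matrix is a value of type \<^typ>\<open>complex ^ 'n ^ 'n\<close>, where \<open>'n\<close> is any finite linearly
  ordered type and \<open>n = CARD('n)\<close>. The order on \<open>'n\<close> says which row and column is the first, the
  second and so on; \<open>idx\<close> numbers them \<open>0, \<dots>, n - 1\<close>.
\<close>

definition idx :: "'n::{finite,linorder} \<Rightarrow> nat" where
  "idx i = card {j. j < i}"

definition shift_matrix :: "complex ^ 'n::{finite,linorder} ^ 'n::{finite,linorder}" where
  "shift_matrix = (\<chi> i j. if idx i = idx j + 1 then 1 else 0)"

definition conj_transpose :: "complex ^ 'n ^ 'm \<Rightarrow> complex ^ 'm ^ 'n" where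
  "conj_transpose A = (\<chi> i j. cnj (A $ j $ i))"

definition displacement ::
  "complex ^ 'n::{finite,linorder} ^ 'n::{finite,linorder}
    \<Rightarrow> complex ^ 'n::{finite,linorder} ^ 'n::{finite,linorder}" where
  "displacement A = A - shift_matrix ** A ** conj_transpose shift_matrix"

definition toeplitz :: "complex ^ 'n::{finite,linorder} ^ 'n::{finite,linorder} \<Rightarrow> bool" where
  "toeplitz A \<longleftrightarrow>
    (\<forall>i j k l. int (idx i) - int (idx j) = int (idx k) - int (idx l) \<longrightarrow> A $ i $ j = A $ k $ l)"

definition diagonal_matrix :: "complex ^ 'n ^ 'n \<Rightarrow> bool" where
  "diagonal_matrix A \<longleftrightarrow> (\<forall>i j. i \<noteq> j \<longrightarrow> A $ i $ j = 0)"

definition diagonalizable :: "complex ^ 'n ^ 'n \<Rightarrow> bool" where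
  "diagonalizable A \<longleftrightarrow>
    (\<exists>X :: complex ^ 'n ^ 'n. invertible X \<and> diagonal_matrix (matrix_inv X ** A ** X))"

definition eigenvalue :: "complex ^ 'n ^ 'n \<Rightarrow> complex \<Rightarrow> bool" where
  "eigenvalue A c \<longleftrightarrow> (\<exists>v. v \<noteq> 0 \<and> A *v v = c *s v)"

text \<open>
  The multiplication of the type class \<^class>\<open>times\<close> is componentwise on vectors, so the powers
  in the exponential series have to be formed with \<open>**\<close>.
\<close>

primrec matrix_power :: "complex ^ 'n ^ 'n \<Rightarrow> nat \<Rightarrow> complex ^ 'n ^ 'n" where
  "matrix_power A 0 = mat 1"
| "matrix_power A (Suc k) = A ** matrix_power A k"

definition matrix_exp :: "complex ^ 'n ^ 'n \<Rightarrow> complex ^ 'n ^ 'n" where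
  "matrix_exp A = (\<Sum>k. (1 / fact k) *\<^sub>R matrix_power A k)"

text \<open>
  The norm of \<^typ>\<open>complex ^ 'n\<close> is the Euclidean one, so this is the spectral norm. (The norm of
  the type \<^typ>\<open>complex ^ 'n ^ 'n\<close> itself is the Frobenius norm.)
\<close>

definition norm2 :: "complex ^ 'n ^ 'n \<Rightarrow> real" where
  "norm2 A = onorm (\<lambda>x. A *v x)"

definition condition_number :: "complex ^ 'n ^ 'n \<Rightarrow> real" where
  "condition_number X = norm2 X * norm2 (matrix_inv X)"

text \<open>
  The error of the best uniform approximation of the exponential function on the negative half-line
  by rational functions of type \<open>(s, s)\<close>. Only denominators without zeros on the half-line are
  admitted, since \<open>x / 0 = 0\<close> in HOL. Polynomials have complex coefficients; the infimum is at most
  the one over real polynomials. Infimum and supremum are taken in \<^typ>\<open>ereal\<close>, so an unbounded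
  error is \<open>\<infinity>\<close>.
\<close>

definition exp_rational_error :: "nat \<Rightarrow> ereal" where
  "exp_rational_error s =
    (INF (p, q) \<in> {(p :: complex poly, q :: complex poly).
        degree p \<le> s \<and> degree q \<le> s \<and> (\<forall>x::real. x \<le> 0 \<longrightarrow> poly q (of_real x) \<noteq> 0)}.
      SUP x \<in> {..0::real}.
        ereal (cmod (exp (of_real x) - poly p (of_real x) / poly q (of_real x))))"

text \<open>
  The property of the constants in the theorem of Gonchar and Rakhmanov, which states that it holds
  for some \<open>C\<close> and for \<open>V\<close> approximately \<open>9.28903\<close>.
\<close>

definition gonchar_rakhmanov :: "real \<Rightarrow> real \<Rightarrow> bool" where
  "gonchar_rakhmanov C V \<longleftrightarrow>
    (\<forall>s\<ge>1. exp_rational_error s \<le> ereal (C * V powi (- int s)))"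

end

theory Submission
  imports Defs
begin

text \<open>
  If \<open>p / q\<close> is a rational function of type \<open>(s, s)\<close> that is within \<open>t\<close> of the exponential function on
  the negative half-line, then \<open>B = e\<^sup>\<mu> p(T') q(T')\<^sup>-\<^sup>1\<close> with \<open>T' = T - \<mu> I\<close> is a candidate for the
  minimum. Since \<open>T\<close> is diagonalized by \<open>X\<close>, the matrix \<open>exp(T) - B\<close> is \<open>X\<close> times a diagonal
  matrix times \<open>X\<^sup>-\<^sup>1\<close>, with diagonal entries \<open>e\<^sup>\<mu> (e\<^sup>y - p(y) / q(y))\<close> where \<open>y + \<mu>\<close> runs through the
  eigenvalues of \<open>T\<close>. As \<open>y \<le> 0\<close>, its norm is at most \<open>\<kappa>(X) e\<^sup>\<mu> t\<close>.

  The displacement rank of \<open>B\<close> is bounded in \<open>rank_displacement_rational_toeplitz_le\<close>. The matrix \<open>T'\<close>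
  is Toeplitz, so its commutator with the shift \<open>Z\<close> vanishes off the first row and the last column and
  has its range in the span of a set \<open>S\<close> of two vectors. With \<open>P = p(T')\<close>, \<open>Q = q(T')\<close> and
  \<open>A = P Q\<^sup>-\<^sup>1 = Q\<^sup>-\<^sup>1 P\<close>,
  \<open>Q (Z A - A Z) Q = Q Z P - P Z Q\<close>,
  which is a combination of the matrices \<open>T'\<^sup>a Z T'\<^sup>b - T'\<^sup>b Z T'\<^sup>a\<close> with \<open>a, b \<le> s\<close>. Each of them maps into
  the span of the at most \<open>2 s\<close> vectors \<open>T'\<^sup>c w\<close> with \<open>c < s\<close> and \<open>w \<in> S\<close>, so the commutator of \<open>A\<close> and \<open>Z\<close> has
  rank at most \<open>2 s\<close>. Finally \<open>I - Z Z\<^sup>*\<close> is the projection onto the first coordinate \<open>e\<close>, whence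
  \<open>A - Z A Z\<^sup>* = A e e\<^sup>* - (Z A - A Z) Z\<^sup>*\<close>: the change from commutator to displacement costs one more
  dimension.

  The infimum over all \<open>p / q\<close> need not be attained, so the bound is first obtained for every
  \<open>t > C V\<^sup>-\<^sup>s\<close>. The minimum over matrices is attained, because the matrices of bounded displacement
  rank form a closed set (\<open>closed_rank_le\<close>), and it inherits the bound in the limit.
\<close>

section \<open>Rank of matrices over a field\<close>

text \<open>
  Expanding every column in a basis of the column space factors \<open>A\<close> through \<open>r = dim (columns A)\<close>
  dimensions. The coordinates form \<open>r\<close> row vectors \<open>R b\<close> that span all rows.
\<close>

lemma dim_rows_le_dim_columns_field:
  fixes A :: "'a::field^'n^'m"
  shows "vec.dim (rows A) \<le> vec.dim (columns A)"
proof -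
  obtain B where B: "B \<subseteq> columns A" "vec.independent B" "columns A \<subseteq> vec.span B"
    "card B = vec.dim (columns A)"
    using vec.basis_exists by blast
  have fin: "finite B"
    using B(2) vec.independent_bound_general by blast
  have "\<exists>u. column j A = (\<Sum>b\<in>B. u b *s b)" for j
  proof -
    have "column j A \<in> vec.span B"
      using B(3) by (auto simp: columns_def)
    then show ?thesis
      using vec.span_finite[OF fin] by auto
  qed
  then obtain u where u: "\<And>j. column j A = (\<Sum>b\<in>B. u j b *s b)"
    by metis
  define R where "R b = (\<chi> j. u j b)" for b
  have "rows A \<subseteq> vec.span (R ` B)"
  proof
    fix r assume "r \<in> rows A"
    then obtain i where r: "r = row i A"
      by (auto simp: rows_def)
    have "r = (\<Sum>b\<in>B. (b $ i) *s R b)"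
    proof (subst vec_eq_iff, intro allI)
      fix j
      have "r $ j = column j A $ i"
        by (simp add: r row_def column_def)
      then show "r $ j = (\<Sum>b\<in>B. (b $ i) *s R b) $ j"
        by (simp add: u R_def mult.commute)
    qed
    moreover have "(\<Sum>b\<in>B. (b $ i) *s R b) \<in> vec.span (R ` B)"
      by (intro vec.span_sum vec.span_scale vec.span_base) auto
    ultimately show "r \<in> vec.span (R ` B)"
      by simp
  qed
  then have "vec.dim (rows A) \<le> card (R ` B)"
    using fin by (intro vec.dim_le_card) auto
  also have "\<dots> \<le> card B"
    using fin by (rule card_image_le)
  finally show ?thesis
    using B(4) by simp
qed

text \<open>
  Since \<open>rank\<close> is the dimension of the row space, this contains the equality of row and column rank.
\<close>

lemma rank_eq_dim_range:
  fixes A :: "'a::field^'n^'m"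
  shows "rank A = vec.dim (range ((*v) A))"
proof -
  have "vec.dim (columns A) \<le> vec.dim (rows A)"
    using dim_rows_le_dim_columns_field[of "transpose A"] by simp
  then have "rank A = vec.dim (columns A)"
    using dim_rows_le_dim_columns_field[of A] by (simp add: row_rank_def_gen)
  also have "columns A = (*v) A ` cart_basis"
  proof -
    have "A *v axis j 1 = column j A" for j
      by (simp add: vec_eq_iff matrix_vector_mult_def column_def axis_def if_distrib cong: if_cong)
    then show ?thesis
      by (auto simp: columns_def cart_basis_def image_iff) metis+
  qed
  also have "vec.dim \<dots> = vec.dim (vec.span ((*v) A ` cart_basis))"
    by simp
  also have "vec.span ((*v) A ` cart_basis) = range ((*v) A)"
    by (simp add: vec.linear_span_image[OF matrix_vector_mul_linear_gen])
  finally show ?thesis .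
qed

lemma rank_le_card_spanning:
  fixes A :: "'a::field^'n^'m"
  assumes "\<And>x. A *v x \<in> vec.span S" and "finite S"
  shows "rank A \<le> card S"
  unfolding rank_eq_dim_range using assms by (intro vec.dim_le_card) auto

lemma scaleR_eq_smult:
  fixes x :: "complex^'n"
  shows "c *\<^sub>R x = complex_of_real c *s x"
  by (subst vec_eq_iff) (simp del: scaleR_conv_of_real, simp add: scaleR_conv_of_real[where 'a=complex])

text \<open>
  A subspace meets the kernel nontrivially as soon as its dimension exceeds the rank; conversely a
  section of \<open>A\<close> over its range is a subspace of dimension \<open>rank A\<close> that meets the kernel only in \<open>0\<close>.
  Asking for a kernel vector of norm 1 makes the condition a compact one, which is what
  closedness of the set of these matrices rests on.
\<close>

lemma rank_le_iff_kernel_meets_subspaces: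
  fixes A :: "complex^'n^'m"
  shows "rank A \<le> k \<longleftrightarrow>
    (\<forall>W. vec.subspace W \<and> k < vec.dim W \<longrightarrow> (\<exists>x \<in> W \<inter> sphere 0 1. A *v x = 0))"
    (is "_ \<longleftrightarrow> ?R")
proof
  assume le: "rank A \<le> k"
  show ?R
  proof (intro allI impI)
    fix W assume W: "vec.subspace W \<and> k < vec.dim (W :: (complex^'n) set)"
    have span_W: "vec.span W = W"
      using W by simp
    have "\<not> inj_on ((*v) A) W"
    proof
      assume inj: "inj_on ((*v) A) W"
      then have "vec.dim ((*v) A ` W) = vec.dim W"
        by (intro vec.dim_image_eq[OF matrix_vector_mul_linear_gen]) (simp only: span_W inj)
      moreover have "vec.dim ((*v) A ` W) \<le> rank A"
        unfolding rank_eq_dim_range by (intro vec.dim_subset) auto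
      ultimately show False using le W by simp
    qed
    then obtain x y where xy: "x \<in> W" "y \<in> W" "A *v x = A *v y" "x \<noteq> y"
      by (auto simp: inj_on_def)
    define z where "z = x - y"
    have z: "z \<in> W" "A *v z = 0" "z \<noteq> 0"
      using xy W by (auto simp: z_def vec.subspace_diff algebra_simps)
    let ?w = "complex_of_real (1 / norm z) *s z"
    have w: "?w = (1 / norm z) *\<^sub>R z"
      by (simp only: scaleR_eq_smult)
    have "?w \<in> W"
      using z W by (simp add: vec.subspace_scale)
    moreover have "A *v ?w = 0"
      using z by (simp add: vec.scale)
    moreover have "norm ?w = 1"
      using z unfolding w by simp
    ultimately show "\<exists>x \<in> W \<inter> sphere 0 1. A *v x = 0"
      by (intro bexI[of _ ?w]) auto
  qed
next
  assume R: ?R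
  show "rank A \<le> k"
  proof (rule ccontr)
    assume "\<not> rank A \<le> k"
    \<comment> \<open>\<open>g\<close> is a linear section of \<open>A\<close> over its range; its image violates \<open>?R\<close>.\<close>
    obtain g where g: "Vector_Spaces.linear (*s) (*s) g"
        "\<And>v. v \<in> range ((*v) A) \<Longrightarrow> A *v g v = v"
      using vec.linear_exists_right_inverse_on[OF matrix_vector_mul_linear_gen vec.subspace_UNIV, of A]
      by auto
    let ?V = "range ((*v) A)"
    have V: "vec.subspace ?V"
      by (intro vec.linear_subspace_image[OF matrix_vector_mul_linear_gen] vec.subspace_UNIV)
    then have span_V: "vec.span ?V = ?V"
      by simp
    have inj: "inj_on g ?V"
      using g(2) by (metis inj_onI)
    have "vec.dim (g ` ?V) = vec.dim ?V"
      by (intro vec.dim_image_eq[OF g(1)]) (simp only: span_V inj)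
    then have "k < vec.dim (g ` ?V)"
      using \<open>\<not> rank A \<le> k\<close> by (simp add: rank_eq_dim_range)
    moreover have "vec.subspace (g ` ?V)"
      by (intro vec.linear_subspace_image[OF g(1)] V)
    ultimately have "\<exists>x \<in> g ` ?V \<inter> sphere 0 1. A *v x = 0"
      using R by blast
    then obtain y where y: "norm (g (A *v y)) = 1" "A *v g (A *v y) = 0"
      by auto
    then have "A *v y = 0"
      using g(2)[of "A *v y"] by simp
    then show False
      using y(1) vec.linear_0[OF g(1)] by simp
  qed
qed

lemma continuous_matrix_vector_mult:
  "continuous_on UNIV (\<lambda>z. snd z *v fst z :: complex^'m)"
  unfolding matrix_vector_mult_def by (intro continuous_intros)

text \<open>
  For a fixed \<open>W\<close>, the matrices that kill some unit vector of \<open>W\<close> form the projection of a closed set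
  along a compact factor, hence a closed set.
\<close>

lemma closed_rank_le:
  "closed {A :: complex^'n^'m. rank A \<le> k}"
proof -
  have "closed {A :: complex^'n^'m. \<exists>x \<in> W \<inter> sphere 0 1. A *v x = 0}"
    if W: "vec.subspace W" for W :: "(complex^'n) set"
  proof -
    have "subspace W"
      unfolding subspace_def
    proof (intro conjI ballI allI)
      fix c :: real and x assume "x \<in> W"
      then show "c *\<^sub>R x \<in> W"
        using W by (simp add: scaleR_eq_smult vec.subspace_scale)
    qed (use W in \<open>auto simp: vec.subspace_0 vec.subspace_add\<close>)
    then have "compact (W \<inter> sphere 0 1)"
      by (intro closed_Int_compact closed_subspace) auto
    moreover have "closed {z :: (complex^'n) \<times> (complex^'n^'m). snd z *v fst z = 0}"
      by (intro closed_Collect_eq continuous_matrix_vector_mult continuous_on_const)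
    ultimately have "closed {A :: complex^'n^'m. \<exists>x. x \<in> W \<inter> sphere 0 1 \<and>
        (x, A) \<in> {z. snd z *v fst z = 0}}"
      by (rule closed_compact_projection)
    then show ?thesis
      by (simp add: Bex_def)
  qed
  then have "closed (\<Inter>W\<in>{W. vec.subspace W \<and> k < vec.dim W}.
      {A :: complex^'n^'m. \<exists>x \<in> W \<inter> sphere 0 1. A *v x = 0})"
    by (intro closed_INT ballI) simp
  also have "\<dots> = {A. rank A \<le> k}"
    unfolding rank_le_iff_kernel_meets_subspaces
    by (rule set_eqI) (simp only: INT_iff mem_Collect_eq Ball_def)
  finally show ?thesis .
qed

section \<open>Toeplitz matrices and the shift\<close>

lemma idx_strict_mono: "i < j \<Longrightarrow> idx i < idx j"
  unfolding idx_def by (intro psubset_card_mono) (auto simp: psubset_eq set_eq_iff)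

lemma idx_eq_iff [simp]: "idx i = idx j \<longleftrightarrow> i = j"
  by (metis idx_strict_mono less_irrefl linorder_neqE)

lemma idx_less_card: "idx (i :: 'n::{finite,linorder}) < CARD('n)"
  unfolding idx_def by (intro psubset_card_mono) auto

lemma ex_idx:
  assumes "m < CARD('n::{finite,linorder})"
  shows "\<exists>i :: 'n. idx i = m"
proof -
  have "range (idx :: 'n \<Rightarrow> nat) = {..<CARD('n)}"
    by (intro card_subset_eq) (auto simp: idx_less_card card_image inj_def)
  then show ?thesis
    using assms by (metis imageE lessThan_iff)
qed

lemma ex_idx_pred:
  fixes i :: "'n::{finite,linorder}"
  assumes "idx i \<noteq> 0"
  shows "\<exists>k :: 'n. idx i = idx k + 1"
proof -
  obtain k :: 'n where "idx k = idx i - 1"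
    using ex_idx[of "idx i - 1", where 'n='n] less_imp_diff_less[OF idx_less_card[of i]] by blast
  then show ?thesis
    using assms by (intro exI[of _ k]) simp
qed

lemma shift_mult_nth:
  "(shift_matrix ** A) $ i $ j = (\<Sum>k\<in>UNIV. if idx i = idx k + 1 then A $ k $ j else 0)"
  by (simp add: matrix_matrix_mult_def shift_matrix_def if_distrib if_distribR cong: if_cong)

lemma mult_shift_nth:
  "(A ** shift_matrix) $ i $ j = (\<Sum>k\<in>UNIV. if idx k = idx j + 1 then A $ i $ k else 0)"
  by (simp add: matrix_matrix_mult_def shift_matrix_def if_distrib cong: if_cong)

lemma sum_delta_idx:
  assumes "\<And>k. P k \<longleftrightarrow> k = l"
  shows "(\<Sum>k\<in>UNIV. if P k then f k else 0) = f (l :: 'n :: finite)"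
  by (simp add: assms)

text \<open>
  Away from the first row and the last column both products only shift the index, to
  \<open>T (i - 1) j\<close> and \<open>T i (j + 1)\<close>. These entries lie on the same diagonal.
\<close>

lemma toeplitz_commutator_nth:
  fixes T :: "complex ^ 'n::{finite,linorder} ^ 'n::{finite,linorder}"
  assumes "toeplitz T" "idx i \<noteq> 0" "idx j \<noteq> CARD('n) - 1"
  shows "(shift_matrix ** T - T ** shift_matrix) $ i $ j = 0"
proof -
  obtain k :: 'n where k: "idx i = idx k + 1"
    using ex_idx_pred assms(2) by blast
  obtain l :: 'n where l: "idx l = idx j + 1"
    using ex_idx[of "idx j + 1", where 'n='n] idx_less_card[of j] assms(3) by fastforce
  have "(shift_matrix ** T) $ i $ j = T $ k $ j"
    unfolding shift_mult_nth by (intro sum_delta_idx) (use k in auto)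
  moreover have "(T ** shift_matrix) $ i $ j = T $ i $ l"
    unfolding mult_shift_nth by (intro sum_delta_idx) (simp only: idx_eq_iff flip: l)
  moreover have "T $ k $ j = T $ i $ l"
    using assms(1) k l unfolding toeplitz_def by (metis add_diff_cancel_right of_nat_add)
  ultimately show ?thesis by simp
qed

lemma range_cross_shaped_matrix:
  fixes M :: "complex ^ 'n ^ 'm"
  assumes "\<And>i j. i \<noteq> i0 \<Longrightarrow> j \<noteq> j0 \<Longrightarrow> M $ i $ j = 0"
  shows "M *v x \<in> vec.span {axis i0 1, column j0 M}"
proof -
  let ?c = "(M *v x) $ i0 - x $ j0 * M $ i0 $ j0"
  have "M *v x = ?c *s axis i0 1 + x $ j0 *s column j0 M"
  proof (subst vec_eq_iff, intro allI)
    fix i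
    show "(M *v x) $ i = (?c *s axis i0 1 + x $ j0 *s column j0 M) $ i"
    proof (cases "i = i0")
      case False
      have "(M *v x) $ i = (\<Sum>j\<in>UNIV. if j = j0 then M $ i $ j0 * x $ j0 else 0)"
        unfolding matrix_vector_mult_def vec_lambda_beta
        by (rule sum.cong) (use assms[OF False] in auto)
      then show ?thesis
        using False by (simp add: column_def axis_def)
    qed (simp add: column_def)
  qed
  then show ?thesis
    by (metis insertI1 insertI2 vec.span_add vec.span_base vec.span_scale singletonI)
qed

text \<open>
  \<open>Z Z\<^sup>*\<close> forgets the first coordinate and fixes the others.
\<close>

lemma mat1_minus_shift_mult_adjoint:
  fixes x :: "complex ^ 'n::{finite,linorder}"
  assumes "idx i0 = 0"
  shows "(mat 1 - shift_matrix ** conj_transpose shift_matrix) *v x = x $ i0 *s axis i0 1"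
proof -
  have *: "(shift_matrix ** conj_transpose shift_matrix) $ i $ j = (if i = j \<and> i \<noteq> i0 then 1 else 0)"
    for i j :: 'n
  proof (cases "idx i = 0")
    case True
    then show ?thesis
      using assms by (auto simp: shift_mult_nth) (metis idx_eq_iff)
  next
    case False
    then obtain k :: 'n where k: "idx i = idx k + 1"
      using ex_idx_pred by blast
    have "(shift_matrix ** conj_transpose shift_matrix) $ i $ j = conj_transpose shift_matrix $ k $ j"
      unfolding shift_mult_nth by (intro sum_delta_idx) (use k in auto)
    also have "\<dots> = (if idx j = idx k + 1 then 1 else 0)"
      by (simp add: conj_transpose_def shift_matrix_def)
    also have "\<dots> = (if i = j \<and> i \<noteq> i0 then 1 else 0)"
      using False assms unfolding k[symmetric] by auto
    finally show ?thesis .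
  qed
  define E :: "complex ^ 'n::{finite,linorder} ^ 'n::{finite,linorder}"
    where "E = mat 1 - shift_matrix ** conj_transpose shift_matrix"
  have E: "E $ i $ j = (if j = i0 then axis i0 1 $ i else 0)" for i j
    by (simp add: E_def * mat_def axis_def)
  have "(E *v x) $ i = x $ i0 * axis i0 1 $ i" for i
  proof -
    have "(E *v x) $ i = (\<Sum>j\<in>UNIV. if j = i0 then axis i0 1 $ i * x $ j else 0)"
      unfolding matrix_vector_mult_def vec_lambda_beta by (rule sum.cong) (simp_all add: E)
    then show ?thesis
      by (simp add: mult.commute)
  qed
  then show ?thesis
    by (simp add: vec_eq_iff flip: E_def)
qed

section \<open>Krylov spaces and commutators\<close>

definition krylov :: "complex ^ 'n ^ 'n \<Rightarrow> (complex ^ 'n) set \<Rightarrow> nat \<Rightarrow> (complex ^ 'n) set" where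
  "krylov T S m = (\<lambda>(c, w). matrix_power T c *v w) ` ({..<m} \<times> S)"

lemma finite_krylov: "finite S \<Longrightarrow> finite (krylov T S m)"
  by (simp add: krylov_def)

lemma card_krylov_le: "finite S \<Longrightarrow> card (krylov T S m) \<le> m * card S"
  unfolding krylov_def by (rule order.trans[OF card_image_le]) (auto simp: card_cartesian_product)

lemma krylov_mono: "m \<le> m' \<Longrightarrow> krylov T S m \<subseteq> krylov T S m'"
  unfolding krylov_def by (intro image_mono Sigma_mono) auto

lemma mult_span_krylov:
  assumes "x \<in> vec.span (krylov T S m)"
  shows "T *v x \<in> vec.span (krylov T S (Suc m))"
proof -
  have "(*v) T ` krylov T S m \<subseteq> krylov T S (Suc m)"
  proof
    fix y assume "y \<in> (*v) T ` krylov T S m"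
    then obtain c w where "c < m" "w \<in> S" "y = matrix_power T (Suc c) *v w"
      by (auto simp: krylov_def matrix_vector_mul_assoc)
    then show "y \<in> krylov T S (Suc m)"
      unfolding krylov_def by (intro image_eqI[where x="(Suc c, w)"]) auto
  qed
  then have "vec.span ((*v) T ` krylov T S m) \<subseteq> vec.span (krylov T S (Suc m))"
    by (rule vec.span_mono)
  then show ?thesis
    using assms by (auto simp: vec.linear_span_image[OF matrix_vector_mul_linear_gen])
qed

lemma power_mult_span_krylov:
  "x \<in> vec.span (krylov T S m) \<Longrightarrow> matrix_power T a *v x \<in> vec.span (krylov T S (a + m))"
  by (induction a) (simp_all add: mult_span_krylov flip: matrix_vector_mul_assoc)

lemma matrix_power_add: "matrix_power A (a + b) = matrix_power A a ** matrix_power A b"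
  by (induction a) (auto simp: matrix_mul_assoc)

text \<open>
  Induction with \<open>[Z, T\<^bsup>m+1\<^esup>] = [Z, T] T\<^sup>m + T [Z, T\<^sup>m]\<close>. Only the leftmost powers of \<open>T\<close> matter for the range.
\<close>

lemma commutator_power_in_span_krylov:
  assumes "\<And>x. Z *v (T *v x) - T *v (Z *v x) \<in> vec.span S"
  shows "Z *v (matrix_power T m *v x) - matrix_power T m *v (Z *v x) \<in> vec.span (krylov T S m)"
proof (induction m)
  case (Suc m)
  let ?y = "matrix_power T m *v x"
  have "S \<subseteq> krylov T S (Suc m)"
  proof
    fix w assume "w \<in> S"
    then show "w \<in> krylov T S (Suc m)"
      unfolding krylov_def by (intro image_eqI[where x="(0, w)"]) auto
  qed
  then have "Z *v (T *v ?y) - T *v (Z *v ?y) \<in> vec.span (krylov T S (Suc m))"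
    using assms vec.span_mono by blast
  moreover have "T *v (Z *v ?y - matrix_power T m *v (Z *v x)) \<in> vec.span (krylov T S (Suc m))"
    using Suc by (rule mult_span_krylov)
  ultimately have "(Z *v (T *v ?y) - T *v (Z *v ?y)) + T *v (Z *v ?y - matrix_power T m *v (Z *v x))
      \<in> vec.span (krylov T S (Suc m))"
    by (rule vec.span_add)
  then show ?case
    by (simp add: matrix_vector_mult_diff_distrib flip: matrix_vector_mul_assoc)
qed (simp add: vec.span_zero)

text \<open>
  For \<open>b = a + m\<close> the difference is \<open>T\<^sup>a [Z, T\<^sup>m] T\<^sup>a\<close>, and \<open>T\<^sup>a\<close> raises the length \<open>m\<close> of the Krylov
  sequence to \<open>a + m = b \<le> s\<close>.
\<close>

lemma antisymmetrized_powers_in_span_krylov: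
  assumes "\<And>x. Z *v (T *v x) - T *v (Z *v x) \<in> vec.span S" "a \<le> s" "b \<le> s"
  shows "matrix_power T a *v (Z *v (matrix_power T b *v x)) -
    matrix_power T b *v (Z *v (matrix_power T a *v x)) \<in> vec.span (krylov T S s)"
  using assms(2,3)
proof (induction a b rule: linorder_wlog)
  case (le a b)
  then obtain m where m: "b = a + m"
    using le_Suc_ex by blast
  let ?y = "matrix_power T a *v x"
  have "matrix_power T a *v (Z *v (matrix_power T m *v ?y) - matrix_power T m *v (Z *v ?y))
      \<in> vec.span (krylov T S (a + m))"
    by (intro power_mult_span_krylov commutator_power_in_span_krylov assms(1))
  moreover have "matrix_power T b *v x = matrix_power T m *v ?y"
    unfolding m by (simp add: add.commute[of a] matrix_power_add flip: matrix_vector_mul_assoc)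
  moreover have "matrix_power T b *v (Z *v ?y) = matrix_power T a *v (matrix_power T m *v (Z *v ?y))"
    unfolding m by (simp add: matrix_power_add flip: matrix_vector_mul_assoc)
  ultimately have "matrix_power T a *v (Z *v (matrix_power T b *v x)) -
      matrix_power T b *v (Z *v ?y) \<in> vec.span (krylov T S b)"
    by (simp add: matrix_vector_mult_diff_distrib m)
  then show ?case
    using vec.span_mono[OF krylov_mono[OF le(3)]] by blast
next
  case (sym a b)
  then show ?case
    by (metis minus_diff_eq vec.span_neg)
qed

section \<open>Displacement rank of rational functions of Toeplitz matrices\<close>

definition matrix_poly :: "complex poly \<Rightarrow> complex ^ 'n ^ 'n \<Rightarrow> complex ^ 'n ^ 'n" where
  "matrix_poly p A = (\<Sum>k\<le>degree p. mat (coeff p k) ** matrix_power A k)"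

lemma matrix_poly_mult_vector:
  fixes A :: "complex ^ 'n ^ 'n"
  shows "matrix_poly p A *v x = (\<Sum>k\<le>degree p. coeff p k *s (matrix_power A k *v x))"
proof -
  have "(\<Sum>k\<in>K. M k) *v x = (\<Sum>k\<in>K. M k *v x)" for K :: "nat set" and M :: "nat \<Rightarrow> complex^'n^'n"
    by (induction K rule: infinite_finite_induct) (auto simp: algebra_simps)
  moreover have "mat c *v y = c *s y" for c and y :: "complex^'n"
    by (simp add: vec_eq_iff matrix_vector_mult_def mat_def if_distrib if_distribR cong: if_cong)
  ultimately show ?thesis
    by (simp add: matrix_poly_def flip: matrix_vector_mul_assoc)
qed

text \<open>
  This is the noncommutative form of the fact that \<open>q(x) p(y) - p(x) q(y)\<close> is divisible by \<open>x - y\<close> with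
  a quotient of degree less than \<open>s\<close> in each variable. Exchanging the summation indices in the second
  product pairs every \<open>T\<^sup>a Z T\<^sup>b\<close> with \<open>T\<^sup>b Z T\<^sup>a\<close>, with the same coefficient.
\<close>

lemma bezout_commutator_in_span_krylov:
  assumes "\<And>x. Z *v (T *v x) - T *v (Z *v x) \<in> vec.span S" "degree p \<le> s" "degree q \<le> s"
  shows "matrix_poly q T *v (Z *v (matrix_poly p T *v x)) -
    matrix_poly p T *v (Z *v (matrix_poly q T *v x)) \<in> vec.span (krylov T S s)"
proof -
  have expand: "matrix_poly f T *v (Z *v (matrix_poly g T *v x)) =
      (\<Sum>a\<le>degree f. \<Sum>b\<le>degree g. (coeff f a * coeff g b) *s
         (matrix_power T a *v (Z *v (matrix_power T b *v x))))" for f g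
    by (subst sum.swap)
      (simp add: matrix_poly_mult_vector vec.sum vec.scale vec.scale_sum_right mult.commute)
  have "matrix_poly q T *v (Z *v (matrix_poly p T *v x)) -
      matrix_poly p T *v (Z *v (matrix_poly q T *v x)) =
    (\<Sum>a\<le>degree q. \<Sum>b\<le>degree p. (coeff q a * coeff p b) *s
       (matrix_power T a *v (Z *v (matrix_power T b *v x)) -
        matrix_power T b *v (Z *v (matrix_power T a *v x))))"
    unfolding expand
    by (subst (2) sum.swap) (simp add: sum_subtractf vec.scale_right_diff_distrib mult.commute)
  also have "\<dots> \<in> vec.span (krylov T S s)"
    using assms by (intro vec.span_sum vec.span_scale antisymmetrized_powers_in_span_krylov) auto
  finally show ?thesis .
qed

text \<open>
  Multiplication by the invertible \<open>q(T)\<close> on both sides turns the commutator of \<open>A = p(T) q(T)\<^sup>-\<^sup>1\<close>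
  with the shift into the Bezout-like difference, whose range has dimension at most \<open>2 s\<close>. The
  displacement is \<open>A (I - Z Z\<^sup>*) - (Z A - A Z) Z\<^sup>*\<close>, and its first summand has range in the line through
  the first column of \<open>A\<close>.
\<close>

theorem rank_displacement_rational_toeplitz_le:
  fixes T A :: "complex ^ 'n::{finite,linorder} ^ 'n::{finite,linorder}"
  assumes "toeplitz T" "degree p \<le> s" "degree q \<le> s"
    and inv: "invertible (matrix_poly q T)"
    and AQ: "A ** matrix_poly q T = matrix_poly p T"
    and QA: "matrix_poly q T ** A = matrix_poly p T"
  shows "rank (displacement A) \<le> 2 * s + 1"
proof -
  let ?Z = "shift_matrix :: complex ^ 'n::{finite,linorder} ^ 'n::{finite,linorder}"
    and ?Q = "matrix_poly q T" and ?P = "matrix_poly p T"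
  obtain i0 :: 'n where i0: "idx i0 = 0"
    using ex_idx[of 0, where 'n='n] by auto
  obtain j0 :: 'n where j0: "idx j0 = CARD('n) - 1"
    using ex_idx[of "CARD('n) - 1", where 'n='n] by auto
  let ?v = "column j0 (?Z ** T - T ** ?Z)"
  define S where "S = {axis i0 1, ?v}"
  define K where "K = krylov T S s"
  obtain R where R: "?Q ** R = mat 1" "R ** ?Q = mat 1"
    using inv by (auto simp: invertible_def)
  have finK: "finite K" and cardK: "card K \<le> s * 2"
  proof -
    show "finite K"
      by (simp add: K_def S_def finite_krylov)
    have "card S \<le> 2"
      by (simp add: S_def card_insert_if)
    then show "card K \<le> s * 2"
      unfolding K_def using card_krylov_le[of S T s]
      by (metis S_def finite.emptyI finite.insertI mult_le_mono2 order.trans)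
  qed
  have rank_two: "?Z *v (T *v x) - T *v (?Z *v x) \<in> vec.span S" for x
  proof -
    have "(?Z ** T - T ** ?Z) *v x \<in> vec.span S"
      unfolding S_def
    proof (rule range_cross_shaped_matrix)
      fix i j assume "i \<noteq> i0" "j \<noteq> j0"
      then show "(?Z ** T - T ** ?Z) $ i $ j = 0"
        using assms(1) i0 j0 by (intro toeplitz_commutator_nth) (metis idx_eq_iff)+
    qed
    then show ?thesis
      by (simp add: algebra_simps matrix_vector_mul_assoc)
  qed
  have commutator: "?Z *v (A *v y) - A *v (?Z *v y) \<in> vec.span ((*v) R ` K)" for y
  proof -
    have RQ: "R *v (?Q *v z) = z" and QR: "?Q *v (R *v z) = z" for z
      by (simp_all add: matrix_vector_mul_assoc R)
    have A1: "?P *v z = ?Q *v (A *v z)" and A2: "?P *v z = A *v (?Q *v z)" for z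
      by (simp_all add: matrix_vector_mul_assoc AQ QA)
    have "?Q *v (?Z *v (?P *v (R *v y))) - ?P *v (?Z *v (?Q *v (R *v y))) \<in> vec.span K"
      unfolding K_def using rank_two assms(2,3) by (rule bezout_commutator_in_span_krylov)
    also have "?P *v (R *v y) = A *v y"
      by (simp add: A2 QR)
    also have "?P *v (?Z *v (?Q *v (R *v y))) = ?Q *v (A *v (?Z *v y))"
      by (simp add: A1 QR)
    finally have "R *v (?Q *v (?Z *v (A *v y)) - ?Q *v (A *v (?Z *v y))) \<in> (*v) R ` vec.span K"
      by blast
    then show ?thesis
      by (simp add: RQ matrix_vector_mult_diff_distrib
          vec.linear_span_image[OF matrix_vector_mul_linear_gen])
  qed
  let ?B = "insert (A *v axis i0 1) ((*v) R ` K)"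
  have "rank (displacement A) \<le> card ?B"
  proof (rule rank_le_card_spanning)
    fix x
    let ?y = "conj_transpose ?Z *v x"
    have "x - ?Z *v ?y = x $ i0 *s axis i0 1"
      using mat1_minus_shift_mult_adjoint[OF i0, of x] by (simp add: algebra_simps matrix_vector_mul_assoc)
    then have "A *v (x - ?Z *v ?y) = x $ i0 *s (A *v axis i0 1)"
      by (simp add: vec.scale)
    then have "A *v (x - ?Z *v ?y) \<in> vec.span ?B"
      by (simp add: vec.span_base vec.span_scale)
    moreover have "?Z *v (A *v ?y) - A *v (?Z *v ?y) \<in> vec.span ?B"
      using commutator vec.span_mono[of "(*v) R ` K" ?B] by blast
    ultimately have "A *v (x - ?Z *v ?y) - (?Z *v (A *v ?y) - A *v (?Z *v ?y)) \<in> vec.span ?B"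
      by (rule vec.span_diff)
    also have "A *v (x - ?Z *v ?y) - (?Z *v (A *v ?y) - A *v (?Z *v ?y)) = displacement A *v x"
      by (simp add: displacement_def algebra_simps flip: matrix_vector_mul_assoc)
    finally show "displacement A *v x \<in> vec.span ?B" .
  qed (use finK in simp)
  also have "card ?B \<le> Suc (card K)"
    using finK card_image_le[OF finK, of "(*v) R"] by (simp add: card_insert_if)
  finally show ?thesis
    using cardK by simp
qed

section \<open>Functions of a diagonalized matrix\<close>

lemma matrix_inv_cancel:
  assumes "invertible X"
  shows "X ** matrix_inv X = mat 1" "matrix_inv X ** X = mat 1"
  using someI_ex[OF assms[unfolded invertible_def]] by (auto simp: matrix_inv_def)

text \<open>
  For invertible \<open>X\<close> and \<open>A = conj_diag X d\<close>, the matrix \<open>conj_diag X (\<lambda>i. f (d i))\<close> is \<open>f(A)\<close>, so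
  that identities between functions of \<open>A\<close> reduce to identities between numbers.
\<close>

definition conj_diag :: "complex ^ 'n ^ 'n \<Rightarrow> ('n \<Rightarrow> complex) \<Rightarrow> complex ^ 'n ^ 'n" where
  "conj_diag X d = X ** (\<chi> i j. if i = j then d i else 0) ** matrix_inv X"

lemma conj_diag_nth:
  "conj_diag X d $ i $ j = (\<Sum>k\<in>UNIV. d k * (X $ i $ k * matrix_inv X $ k $ j))"
  by (simp add: conj_diag_def matrix_matrix_mult_def if_distrib ac_simps cong: if_cong)

lemma conj_diag_diff: "conj_diag X d - conj_diag X e = conj_diag X (\<lambda>i. d i - e i)"
  by (simp add: vec_eq_iff conj_diag_nth sum_subtractf algebra_simps)

lemma conj_diag_const:
  assumes "invertible X"
  shows "conj_diag X (\<lambda>_. c) = mat c"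
proof -
  have "conj_diag X (\<lambda>_. c) $ i $ j = c * (X ** matrix_inv X) $ i $ j" for i j
    by (simp add: conj_diag_nth matrix_matrix_mult_def sum_distrib_left)
  then show ?thesis
    by (simp add: matrix_inv_cancel[OF assms] vec_eq_iff mat_def)
qed

lemma conj_diag_mult:
  assumes "invertible X"
  shows "conj_diag X d ** conj_diag X e = conj_diag X (\<lambda>i. d i * e i)"
proof -
  let ?D = "\<lambda>d :: 'a \<Rightarrow> complex. (\<chi> i j. if i = j then d i else 0) :: complex ^ 'a ^ 'a"
  have "conj_diag X d ** conj_diag X e = X ** ?D d ** (matrix_inv X ** X) ** ?D e ** matrix_inv X"
    unfolding conj_diag_def by (simp only: matrix_mul_assoc)
  also have "\<dots> = X ** (?D d ** ?D e) ** matrix_inv X"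
    by (simp add: matrix_inv_cancel[OF assms] matrix_mul_assoc)
  also have "?D d ** ?D e = ?D (\<lambda>i. d i * e i)"
  proof -
    have "(?D d ** ?D e) $ i $ j = (\<Sum>k\<in>UNIV. if k = i then if i = j then d i * e i else 0 else 0)" for i j
      unfolding matrix_matrix_mult_def vec_lambda_beta by (rule sum.cong) auto
    then show ?thesis by (simp add: vec_eq_iff)
  qed
  finally show ?thesis by (simp add: conj_diag_def)
qed

lemma matrix_power_conj_diag:
  assumes "invertible X"
  shows "matrix_power (conj_diag X d) k = conj_diag X (\<lambda>i. d i ^ k)"
  by (induction k) (simp_all add: conj_diag_mult[OF assms] conj_diag_const[OF assms])

lemma matrix_poly_conj_diag:
  assumes "invertible X"
  shows "matrix_poly p (conj_diag X d) = conj_diag X (\<lambda>i. poly p (d i))"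
proof -
  have mat_mult: "(mat c ** A) $ i $ j = c * A $ i $ j" for c i j and A :: "complex ^ 'a ^ 'a"
    by (simp add: matrix_matrix_mult_def mat_def if_distrib if_distribR cong: if_cong)
  have "matrix_poly p (conj_diag X d) $ i $ j = conj_diag X (\<lambda>i. poly p (d i)) $ i $ j" for i j
  proof -
    have "matrix_poly p (conj_diag X d) $ i $ j = (\<Sum>m\<le>degree p. \<Sum>k\<in>UNIV.
        coeff p m * d k ^ m * (X $ i $ k * matrix_inv X $ k $ j))"
      by (simp add: matrix_poly_def mat_mult matrix_power_conj_diag[OF assms] conj_diag_nth
          sum_distrib_left mult.assoc)
    also have "\<dots> = (\<Sum>k\<in>UNIV. \<Sum>m\<le>degree p.
        coeff p m * d k ^ m * (X $ i $ k * matrix_inv X $ k $ j))"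
      by (rule sum.swap)
    finally show ?thesis
      by (simp add: conj_diag_nth poly_altdef sum_distrib_right)
  qed
  then show ?thesis
    by (simp add: vec_eq_iff)
qed

lemma matrix_exp_conj_diag:
  fixes X :: "complex ^ 'n ^ 'n"
  assumes "invertible X"
  shows "matrix_exp (conj_diag X d) = conj_diag X (\<lambda>i. exp (d i))"
proof -
  have scale: "c *\<^sub>R conj_diag X e = conj_diag X (\<lambda>i. c *\<^sub>R e i)" for c e
    by (simp add: vec_eq_iff conj_diag_nth scaleR_sum_right)
  have "(\<lambda>m. conj_diag X (\<lambda>i. d i ^ m /\<^sub>R fact m) $ i $ j) sums conj_diag X (\<lambda>i. exp (d i)) $ i $ j"
    for i j
    unfolding conj_diag_nth by (intro sums_sum sums_mult2 exp_converges)
  then have "(\<lambda>m. conj_diag X (\<lambda>i. d i ^ m /\<^sub>R fact m)) sums conj_diag X (\<lambda>i. exp (d i))"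
    unfolding sums_def by (intro vec_tendstoI) simp
  then show ?thesis
    unfolding matrix_exp_def matrix_power_conj_diag[OF assms] scale
    by (intro sums_unique[symmetric]) (simp add: divide_inverse)
qed

section \<open>The spectral norm and best approximation\<close>

lemma bounded_linear_matrix_vector_mult:
  "bounded_linear (\<lambda>x. (A :: complex ^ 'n ^ 'm) *v x)"
  using matrix_vector_mul_linear linear_conv_bounded_linear by blast

lemma norm2_mult_le: "norm2 (A ** B) \<le> norm2 A * norm2 B"
  unfolding norm2_def
  using onorm_compose[OF bounded_linear_matrix_vector_mult[of A] bounded_linear_matrix_vector_mult[of B]]
  by (simp add: o_def matrix_vector_mul_assoc)

lemma norm2_nonneg: "0 \<le> norm2 A"
  unfolding norm2_def by (rule onorm_pos_le[OF bounded_linear_matrix_vector_mult])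

lemma norm2_diag_le:
  assumes "\<And>i. cmod (d i) \<le> e"
  shows "norm2 (\<chi> i j. if i = j then d i else 0) \<le> e"
  unfolding norm2_def
proof (rule onorm_le)
  fix x :: "complex ^ 'a"
  let ?D = "(\<chi> i j. if i = j then d i else 0) :: complex ^ 'a ^ 'a"
  have e: "0 \<le> e"
    using assms[of undefined] norm_ge_zero order.trans by blast
  have D: "(?D *v x) $ i = d i * x $ i" for i
    by (simp add: matrix_vector_mult_def if_distrib if_distribR cong: if_cong)
  have "norm (?D *v x) \<le> L2_set (\<lambda>i. e * norm (x $ i)) UNIV"
    unfolding norm_vec_def D norm_mult by (intro L2_set_mono mult_right_mono assms) auto
  then show "norm (?D *v x) \<le> e * norm x"
    using e by (simp add: norm_vec_def L2_set_right_distrib)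
qed

lemma norm2_conj_diag_le:
  assumes "\<And>i. cmod (d i) \<le> e"
  shows "norm2 (conj_diag X d) \<le> condition_number X * e"
proof -
  have "norm2 (conj_diag X d) \<le> norm2 X * norm2 (\<chi> i j. if i = j then d i else 0) * norm2 (matrix_inv X)"
    unfolding conj_diag_def
    by (intro order.trans[OF norm2_mult_le] mult_right_mono norm2_mult_le norm2_nonneg)
  also have "\<dots> \<le> norm2 X * e * norm2 (matrix_inv X)"
    by (intro mult_right_mono mult_left_mono norm2_diag_le assms norm2_nonneg)
  finally show ?thesis
    by (simp add: condition_number_def mult_ac)
qed

text \<open>
  \<open>norm2\<close> is the norm of the type of bounded linear functions, pulled back along a linear map, and linear
  maps on a finite-dimensional space are continuous.
\<close>

lemma continuous_on_norm2: "continuous_on S norm2"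
proof -
  let ?L = "\<lambda>A. Blinfun ((*v) (A :: complex ^ 'a ^ 'b))"
  have apply_L: "blinfun_apply (?L A) = (*v) A" for A
    by (rule bounded_linear_Blinfun_apply[OF bounded_linear_matrix_vector_mult])
  have "linear ?L"
    by (intro linearI blinfun_eqI)
      (simp_all add: apply_L blinfun.add_left blinfun.scaleR_left matrix_vector_mult_def
        vec_eq_iff scaleR_sum_right sum.distrib distrib_right)
  then have "continuous_on S (\<lambda>A. norm (?L A))"
    by (intro continuous_on_norm linear_continuous_on) (simp add: linear_conv_bounded_linear)
  then show ?thesis
    by (simp add: norm_blinfun.rep_eq apply_L norm2_def[abs_def])
qed

text \<open>
  A crude comparison with the Frobenius norm suffices: it shows that the sublevel sets of \<open>norm2\<close> are
  bounded, and hence compact when closed.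
\<close>

lemma norm_le_norm2: "norm A \<le> real CARD('n) * real CARD('n) * norm2 (A :: complex ^ 'n ^ 'n)"
proof -
  have entry: "cmod (A $ i $ j) \<le> norm2 A" for i j
  proof -
    have "A $ i $ j = (A *v axis j 1) $ i"
      by (simp add: matrix_vector_mult_def axis_def if_distrib cong: if_cong)
    also have "cmod \<dots> \<le> norm (A *v axis j 1)"
      by (rule Finite_Cartesian_Product.norm_nth_le)
    also have "\<dots> \<le> norm2 A * norm (axis j 1 :: complex ^ 'n)"
      unfolding norm2_def by (rule onorm[OF bounded_linear_matrix_vector_mult])
    finally show ?thesis by simp
  qed
  have "norm A \<le> (\<Sum>i\<in>UNIV. norm (A $ i))"
    unfolding norm_vec_def[of A] by (intro L2_set_le_sum) auto
  also have "\<dots> \<le> (\<Sum>i\<in>(UNIV::'n set). \<Sum>j\<in>(UNIV::'n set). cmod (A $ i $ j))"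
    unfolding norm_vec_def by (intro sum_mono L2_set_le_sum) auto
  also have "\<dots> \<le> (\<Sum>i\<in>(UNIV::'n set). \<Sum>j\<in>(UNIV::'n set). norm2 A)"
    by (intro sum_mono entry)
  finally show ?thesis by simp
qed

text \<open>
  The competitors that are no worse than a fixed element of \<open>S\<close> form a compact set.
\<close>

lemma norm2_distance_attains_inf:
  fixes S :: "(complex ^ 'n ^ 'n) set"
  assumes "closed S" "S \<noteq> {}"
  shows "\<exists>A\<in>S. \<forall>B\<in>S. norm2 (E - A) \<le> norm2 (E - B)"
proof -
  obtain B0 where B0: "B0 \<in> S" using assms(2) by blast
  define K where "K = S \<inter> {B. norm2 (E - B) \<le> norm2 (E - B0)}"
  have cont: "continuous_on UNIV (\<lambda>B. norm2 (E - B))"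
    by (intro continuous_on_compose2[OF continuous_on_norm2[of UNIV]] continuous_intros) auto
  have "closed K"
    unfolding K_def using cont by (intro closed_Int assms closed_Collect_le continuous_on_const)
  moreover have "K \<subseteq> cball E (real CARD('n) * real CARD('n) * norm2 (E - B0))"
  proof
    fix B assume "B \<in> K"
    then have "norm2 (E - B) \<le> norm2 (E - B0)"
      by (simp add: K_def)
    then have "real CARD('n) * real CARD('n) * norm2 (E - B) \<le>
        real CARD('n) * real CARD('n) * norm2 (E - B0)"
      by (intro mult_left_mono) auto
    then show "B \<in> cball E (real CARD('n) * real CARD('n) * norm2 (E - B0))"
      unfolding mem_cball dist_norm by (rule order.trans[OF norm_le_norm2])
  qed
  ultimately have "compact K"
    using bounded_cball bounded_subset compact_eq_bounded_closed by blast
  moreover have "B0 \<in> K"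
    using B0 by (simp add: K_def)
  ultimately obtain A where A: "A \<in> K" "\<And>B. B \<in> K \<Longrightarrow> norm2 (E - A) \<le> norm2 (E - B)"
    using continuous_attains_inf[of K "\<lambda>B. norm2 (E - B)"] continuous_on_subset[OF cont, of K] by blast
  have "norm2 (E - A) \<le> norm2 (E - B)" if "B \<in> S" for B
  proof (cases "B \<in> K")
    case False
    then have "norm2 (E - B0) \<le> norm2 (E - B)"
      using that by (simp add: K_def)
    then show ?thesis
      using A(2)[OF \<open>B0 \<in> K\<close>] by simp
  qed (rule A(2))
  then show ?thesis
    using A(1) by (auto simp: K_def)
qed

lemma closed_rank_displacement_le: "closed {B. rank (displacement B) \<le> k}"
proof -
  have "continuous_on UNIV (displacement :: complex ^ 'n::{finite,linorder} ^ 'n::{finite,linorder} \<Rightarrow> _)"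
    unfolding displacement_def matrix_matrix_mult_def by (intro continuous_intros)
  then show ?thesis
    using closed_vimage[OF closed_rank_le] by (simp add: vimage_def)
qed

section \<open>Approximation of the matrix exponential\<close>

lemma toeplitz_minus_mat:
  fixes T :: "complex ^ 'n::{finite,linorder} ^ 'n::{finite,linorder}"
  assumes "toeplitz T"
  shows "toeplitz (T - mat c)"
  unfolding toeplitz_def
proof (intro allI impI)
  fix i j k l :: 'n
  assume eq: "int (idx i) - int (idx j) = int (idx k) - int (idx l)"
  then have "T $ i $ j = T $ k $ l"
    using assms unfolding toeplitz_def by blast
  moreover have "idx i = idx j \<longleftrightarrow> idx k = idx l"
    using eq by linarith
  ultimately show "(T - mat c) $ i $ j = (T - mat c) $ k $ l"
    by (simp add: mat_def)
qed

lemma diagonalization: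
  fixes T X :: "complex ^ 'n ^ 'n"
  assumes X: "invertible X" and diag: "diagonal_matrix (matrix_inv X ** T ** X)"
  obtains d where "T = conj_diag X d" "\<And>i. eigenvalue T (d i)"
proof
  define D where "D = matrix_inv X ** T ** X"
  define d where "d i = D $ i $ i" for i
  note inv = matrix_inv_cancel[OF X]
  have D: "D = (\<chi> i j. if i = j then d i else 0)"
    using diag by (simp add: vec_eq_iff diagonal_matrix_def D_def d_def)
  have "X ** D ** matrix_inv X = (X ** matrix_inv X) ** T ** (X ** matrix_inv X)"
    unfolding D_def by (simp only: matrix_mul_assoc)
  then show T: "T = conj_diag X d"
    by (simp add: inv conj_diag_def flip: D)
  show "eigenvalue T (d i)" for i
    unfolding eigenvalue_def
  proof (intro exI conjI)
    have "X ** D = (X ** matrix_inv X) ** T ** X"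
      unfolding D_def by (simp only: matrix_mul_assoc)
    then have "T ** X = X ** D"
      by (simp add: inv)
    moreover have "D *v axis i 1 = d i *s axis i 1"
    proof -
      have "(D *v axis i 1) $ j = (\<Sum>k\<in>UNIV. if k = i then if j = i then d i else 0 else 0)" for j
        unfolding matrix_vector_mult_def vec_lambda_beta D by (rule sum.cong) (auto simp: axis_def)
      then show ?thesis
        by (simp add: vec_eq_iff axis_def)
    qed
    ultimately show "T *v (X *v axis i 1) = d i *s (X *v axis i 1)"
      by (metis matrix_vector_mul_assoc vec.scale)
    have "matrix_inv X *v (X *v axis i 1) = axis i (1 :: complex)"
      by (simp add: matrix_vector_mul_assoc inv)
    then show "X *v axis i 1 \<noteq> 0"
      by (metis axis_eq_0_iff matrix_vector_mult_0_right zero_neq_one)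
  qed
qed

text \<open>
  The shift by \<open>\<mu>\<close> moves the spectrum to the half-line on which \<open>p / q\<close> is controlled, and preserves the
  Toeplitz structure. The factor \<open>e\<^sup>\<mu>\<close> that compensates for it is absorbed into the numerator, so the
  degrees do not change.
\<close>

lemma rational_approximation_of_matrix_exp:
  fixes T X :: "complex ^ 'n::{finite,linorder} ^ 'n::{finite,linorder}"
  assumes T: "toeplitz T" "\<And>c. eigenvalue T c \<Longrightarrow> c \<in> complex_of_real ` {..\<mu>}"
    and X: "invertible X" "diagonal_matrix (matrix_inv X ** T ** X)"
    and pq: "degree p \<le> s" "degree q \<le> s" "\<And>x::real. x \<le> 0 \<Longrightarrow> poly q (of_real x) \<noteq> 0"
    and err: "\<And>x::real. x \<le> 0 \<Longrightarrow>
      cmod (exp (of_real x) - poly p (of_real x) / poly q (of_real x)) \<le> t"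
  shows "\<exists>B. rank (displacement B) \<le> 2 * s + 1 \<and>
    norm2 (matrix_exp T - B) \<le> condition_number X * exp \<mu> * t"
proof -
  obtain d where d: "T = conj_diag X d" "\<And>i. eigenvalue T (d i)"
    using diagonalization[OF X] by blast
  have "\<exists>x::real. x \<le> 0 \<and> d i = of_real \<mu> + of_real x" for i
    using T(2)[OF d(2)[of i]] by (force intro: exI[of _ "_ - \<mu>"])
  then obtain x :: "'n \<Rightarrow> real" where x: "\<And>i. x i \<le> 0" "\<And>i. d i = of_real \<mu> + of_real (x i)"
    by metis
  let ?e = "complex_of_real (exp \<mu>)"
  define y where "y i = complex_of_real (x i)" for i
  define B where "B = conj_diag X (\<lambda>i. ?e * (poly p (y i) / poly q (y i)))"
  define T' where "T' = T - mat (of_real \<mu>)"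
  have T': "T' = conj_diag X y"
    unfolding T'_def d(1) by (simp add: x(2) y_def[abs_def] conj_diag_diff flip: conj_diag_const[OF X(1)])
  have q0: "poly q (y i) \<noteq> 0" for i
    unfolding y_def by (intro pq x)
  have "rank (displacement B) \<le> 2 * s + 1"
  proof (rule rank_displacement_rational_toeplitz_le)
    show "toeplitz T'"
      unfolding T'_def by (intro toeplitz_minus_mat T)
    show "degree (smult ?e p) \<le> s" "degree q \<le> s"
      using pq by simp_all
    have "conj_diag X (\<lambda>i. poly q (y i)) ** conj_diag X (\<lambda>i. 1 / poly q (y i)) = mat 1"
      "conj_diag X (\<lambda>i. 1 / poly q (y i)) ** conj_diag X (\<lambda>i. poly q (y i)) = mat 1"
      using q0 by (simp_all add: conj_diag_mult conj_diag_const X)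
    then show "invertible (matrix_poly q T')"
      unfolding T' matrix_poly_conj_diag[OF X(1)] invertible_def by blast
    show "B ** matrix_poly q T' = matrix_poly (smult ?e p) T'"
      "matrix_poly q T' ** B = matrix_poly (smult ?e p) T'"
      unfolding T' matrix_poly_conj_diag[OF X(1)] B_def conj_diag_mult[OF X(1)]
      using q0 by simp_all
  qed
  moreover have "norm2 (matrix_exp T - B) \<le> condition_number X * (exp \<mu> * t)"
    unfolding B_def d(1) matrix_exp_conj_diag[OF X(1)] conj_diag_diff
  proof (rule norm2_conj_diag_le)
    fix i
    have "exp (d i) - ?e * (poly p (y i) / poly q (y i)) =
        ?e * (exp (y i) - poly p (y i) / poly q (y i))"
      by (simp add: x(2) y_def exp_add right_diff_distrib flip: exp_of_real)
    also have "cmod \<dots> \<le> exp \<mu> * t"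
      unfolding norm_mult y_def using err[OF x(1)[of i]] by simp
    finally show "cmod (exp (d i) - ?e * (poly p (y i) / poly q (y i))) \<le> exp \<mu> * t" .
  qed
  ultimately show ?thesis
    by (auto simp: mult.assoc)
qed

theorem corollary3p10:
  fixes T X :: "complex ^ 'n::{finite,linorder} ^ 'n::{finite,linorder}"
    and \<mu> C V :: real and s :: nat
  assumes "gonchar_rakhmanov C V"
    and "toeplitz T"
    and "diagonalizable T"
    and "\<And>c. eigenvalue T c \<Longrightarrow> c \<in> complex_of_real ` {..\<mu>}"
    and "invertible X"
    and "diagonal_matrix (matrix_inv X ** T ** X)"
    and "s \<ge> 1"
  shows "\<exists>A. is_arg_min (\<lambda>B. norm2 (matrix_exp T - B))
                 (\<lambda>B. rank (displacement B) \<le> 2 * s + 1) A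
           \<and> norm2 (matrix_exp T - A) \<le> condition_number X * exp \<mu> * C * V powi (- int s)"
proof -
  let ?S = "{B :: complex ^ 'n::{finite,linorder} ^ 'n::{finite,linorder}.
    rank (displacement B) \<le> 2 * s + 1}"
  let ?f = "\<lambda>B. norm2 (matrix_exp T - B)"
  define c where "c = C * V powi (- int s)"
  define k where "k = condition_number X * exp \<mu>"
  \<comment> \<open>The infimum in \<open>exp_rational_error\<close> need not be attained, so only \<open>t > c\<close> is available here.\<close>
  have approx: "\<exists>B\<in>?S. ?f B \<le> k * t" if "c < t" for t
  proof -
    have "exp_rational_error s < ereal t"
      using assms(1,7) that unfolding gonchar_rakhmanov_def c_def
      by (metis le_less_trans less_ereal.simps(1))
    then obtain p q where pq: "degree p \<le> s" "degree q \<le> s"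
      "\<And>x::real. x \<le> 0 \<Longrightarrow> poly q (of_real x) \<noteq> 0"
      and SUP: "(SUP x \<in> {..0::real}.
        ereal (cmod (exp (of_real x) - poly p (of_real x) / poly q (of_real x)))) < ereal t"
      unfolding exp_rational_error_def INF_less_iff by auto
    have "cmod (exp (of_real x) - poly p (of_real x) / poly q (of_real x)) \<le> t"
      if "x \<le> 0" for x :: real
    proof -
      have "ereal (cmod (exp (of_real x) - poly p (of_real x) / poly q (of_real x))) < ereal t"
        using that by (intro le_less_trans[OF SUP_upper SUP]) simp
      then show ?thesis by simp
    qed
    then show ?thesis
      using rational_approximation_of_matrix_exp[OF assms(2,4,5,6) pq] unfolding k_def by blast
  qed
  have "?S \<noteq> {}"
    using approx[of "c + 1"] by auto
  then obtain A where A: "A \<in> ?S" "\<And>B. B \<in> ?S \<Longrightarrow> ?f A \<le> ?f B"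
    using norm2_distance_attains_inf[OF closed_rank_displacement_le \<open>?S \<noteq> {}\<close>, of "matrix_exp T"]
    by auto
  have "?f A \<le> k * t" if "c < t" for t
    using approx[OF that] A(2) by (meson order.trans)
  moreover have "((\<lambda>t. k * t) \<longlongrightarrow> k * c) (at_right c)"
    by (intro tendsto_intros)
  ultimately have "?f A \<le> k * c"
    by (intro tendsto_lowerbound[of _ _ "at_right c"]) (auto simp: eventually_at_right_less
        intro: eventually_mono[OF eventually_at_right_less])
  moreover have "is_arg_min ?f (\<lambda>B. rank (displacement B) \<le> 2 * s + 1) A"
    using A by (auto simp: is_arg_min_def not_less)
  ultimately show ?thesis
    by (intro exI[of _ A]) (simp add: k_def c_def mult.assoc)
qed

end
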